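(* Let $k\ge2$ and let $G$ be a $k$-graph with $n$ vertices in which every vertex lies in at least one edge, with edge connectivity $e(G)$ and analytic connectivity $\alpha(G)$. Then $$e(G)\ge\frac nk\,\alpha(G).$$
   Context: A $k$-graph $G=(V,E)$ consists of a vertex set $V=\{1,\dots,n\}$ and a set $E$ of distinct $k$-element subsets of $V$ (edges). Standing assumption: every vertex lies in at least one edge. The degree $d_i$ of vertex $i$ is the number of edges containing $i$. For a proper nonempty subset $S$ of $V$ with complement $\bar S=V\setminus S$, the edge cut $E(S,\bar S)$ is the set of edges that contain at least one vertex of $S$ and at least one vertex of $\bar S$. The edge connectivity $e(G)$ is the minimum of $|E(S,\bar S)|$ over all proper nonempty subsets $S$ of $V$. The adjacency tensor $\mathcal A=(a_{i_1\cdots i_k})$ is the $k$th order $n$-dimensional symmetric tensor with $a_{i_1\cdots i_k}=\frac1{(k-1)!}$ if $\{i_1,\dots,i_k\}\in E$ (in particular the indices are then distinct), and $0$ otherwise. The degree tensor $\mathcal D$ is the $k$th order $n$-dimensional diagonal tensor with $i$th diagonal entry $d_i$. The Laplacian tensor is $\mathcal L=\mathcal D-\mathcal A$. For a tensor $\mathcal T=(t_{i_1\cdots i_k})$, $\mathcal Tx^k=\sum_{i_1,\dots,i_k=1}^n t_{i_1\cdots i_k}x_{i_1}\cdots x_{i_k}$. With $\mathbb R^n_+$ the set of vectors in $\mathbb R^n$ with nonnegative components, the analytic connectivity of $G$ is $$\alpha(G)=\min_{j=1,\dots,n}\ \min\Big\{\mathcal Lx^k : x\in\mathbb R^n_+,\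 \sum_{i=1}^n x_i^k=1,\ x_j=0\Big\}.$$ *)

theory Defs
  imports "HOL-Analysis.Analysis"
begin

text \<open>
  Vertices are the elements of a finite type \<open>'n\<close>, so \<open>V = UNIV\<close>, \<open>n = CARD('n)\<close> and vectors
  of \<open>\<real>\<^sup>n\<close> have type \<open>real ^ 'n\<close>. A hypergraph on this vertex set is given by its edge set.
\<close>

definition k_graph :: "nat \<Rightarrow> 'n::finite set set \<Rightarrow> bool" where
  "k_graph k E \<longleftrightarrow> (\<forall>e\<in>E. card e = k)"

definition no_isolated_vertices :: "'n::finite set set \<Rightarrow> bool" where
  "no_isolated_vertices E \<longleftrightarrow> (\<forall>i. \<exists>e\<in>E. i \<in> e)"

definition degree :: "'n::finite set set \<Rightarrow> 'n \<Rightarrow> nat" where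
  "degree E i = card {e \<in> E. i \<in> e}"

definition edge_cut :: "'n::finite set set \<Rightarrow> 'n set \<Rightarrow> 'n set set" where
  "edge_cut E S = {e \<in> E. e \<inter> S \<noteq> {} \<and> e \<inter> (UNIV - S) \<noteq> {}}"

definition edge_connectivity :: "'n::finite set set \<Rightarrow> nat" where
  "edge_connectivity E = Min {card (edge_cut E S) | S. S \<noteq> {} \<and> S \<noteq> UNIV}"

text \<open>
  A tensor of order \<open>k\<close> maps each index list \<open>[i\<^sub>1, \<dots>, i\<^sub>k]\<close> to a real entry;
  its values on lists of any other length are irrelevant.
\<close>

type_synonym 'n tensor = "'n list \<Rightarrow> real"

definition tensor_form :: "nat \<Rightarrow> 'n::finite tensor \<Rightarrow> real ^ 'n \<Rightarrow> real" where
  "tensor_form k T x = (\<Sum>is | length is = k. T is * (\<Prod>m<k. x $ (is ! m)))"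

definition adjacency_tensor :: "nat \<Rightarrow> 'n::finite set set \<Rightarrow> 'n tensor" where
  "adjacency_tensor k E is = (if set is \<in> E then 1 / fact (k - 1) else 0)"

definition degree_tensor :: "nat \<Rightarrow> 'n::finite set set \<Rightarrow> 'n tensor" where
  "degree_tensor k E is = (if \<exists>i. is = replicate k i then real (degree E (hd is)) else 0)"

definition laplacian_tensor :: "nat \<Rightarrow> 'n::finite set set \<Rightarrow> 'n tensor" where
  "laplacian_tensor k E is = degree_tensor k E is - adjacency_tensor k E is"

definition feasible :: "nat \<Rightarrow> 'n::finite \<Rightarrow> (real ^ 'n) set" where
  "feasible k j = {x. (\<forall>i. 0 \<le> x $ i) \<and> (\<Sum>i\<in>UNIV. (x $ i) ^ k) = 1 \<and> x $ j = 0}"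

text \<open>
  The inner infimum is a minimum whenever \<open>k\<close> is positive and there are at least two vertices;
  see \<open>feasible_attains_INF\<close> below.
\<close>

definition analytic_connectivity :: "nat \<Rightarrow> 'n::finite set set \<Rightarrow> real" where
  "analytic_connectivity k E =
     (MIN j. INF x\<in>feasible k j. tensor_form k (laplacian_tensor k E) x)"

lemma compact_feasible:
  assumes "k > 0"
  shows "compact (feasible k (j :: 'n::finite))"
proof -
  have eq: "feasible k j = (\<Inter>i. {x. 0 \<le> x $ i}) \<inter> {x. (\<Sum>i\<in>UNIV. (x $ i) ^ k) = 1} \<inter> {x. x $ j = 0}"
    by (auto simp: feasible_def)
  have "closed (feasible k j)"
    unfolding eq
    by (intro closed_Int closed_INT ballI closed_Collect_le closed_Collect_eq continuous_intros)
  moreover have "feasible k j \<subseteq> cbox 0 (\<chi> i. 1)"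
  proof
    fix x :: "real ^ 'n" assume x: "x \<in> feasible k j"
    have "x $ i \<le> 1" for i
    proof (rule ccontr)
      assume "\<not> x $ i \<le> 1"
      then have "1 < (x $ i) ^ k"
        using assms by (intro one_less_power) auto
      also have "\<dots> \<le> (\<Sum>i\<in>UNIV. (x $ i) ^ k)"
        using x by (intro member_le_sum) (auto simp: feasible_def)
      finally show False
        using x by (simp add: feasible_def)
    qed
    then show "x \<in> cbox 0 (\<chi> i. 1)"
      using x by (auto simp: mem_box_cart feasible_def)
  qed
  ultimately show ?thesis
    using compact_cbox closed_Int_compact by (metis inf.absorb1)
qed

lemma feasible_nonempty:
  assumes "k > 0" "CARD('n::finite) \<ge> 2"
  shows "feasible k (j :: 'n) \<noteq> {}"
proof -
  have "UNIV \<noteq> {j}"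
    using assms by (metis One_nat_def card.empty card.insert empty_iff finite.emptyI
        not_less_eq_eq numeral_2_eq_2 order_refl)
  then obtain l where "l \<noteq> j"
    by blast
  have "(if i = l then 1 else (0::real)) ^ k = (if i = l then 1 else 0)" for i
    using assms by simp
  then have "axis l 1 \<in> feasible k j"
    using \<open>l \<noteq> j\<close> by (simp add: feasible_def axis_def)
  then show ?thesis
    by blast
qed

lemma continuous_on_tensor_form: "continuous_on A (tensor_form k T)"
  unfolding tensor_form_def by (intro continuous_intros)

lemma feasible_attains_INF:
  assumes "k > 0" "CARD('n::finite) \<ge> 2"
  shows "\<exists>x\<in>feasible k (j :: 'n). tensor_form k T x = (INF y\<in>feasible k j. tensor_form k T y)"
proof -
  obtain x where x: "x \<in> feasible k j" "\<forall>y\<in>feasible k j. tensor_form k T x \<le> tensor_form k T y"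
    using continuous_attains_inf[OF compact_feasible feasible_nonempty continuous_on_tensor_form]
      assms by metis
  then have "(INF y\<in>feasible k j. tensor_form k T y) = tensor_form k T x"
    by (intro cInf_eq_minimum) auto
  with x show ?thesis
    by metis
qed

end

theory Submission
  imports Defs "HOL-Combinatorics.Multiset_Permutations"
begin

text \<open>
  Evaluating the Laplacian form at the normalised indicator vector of \<open>S\<close> gives
  \<open>card S * \<alpha> \<le> (\<Sum>e\<in>edge_cut E S. card (e \<inter> S))\<close>, since edges inside \<open>S\<close> cancel. Adding the same
  inequality for the complement of \<open>S\<close> turns the right-hand side into \<open>k * card (edge_cut E S)\<close>.
\<close>

lemma finite_lists_length [simp]: "finite {is :: 'n::finite list. length is = k}"
  using finite_lists_length_eq[of "UNIV :: 'n set" k] by simp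

text \<open>Only constant index lists contribute, which leaves the sum of
  \<open>degree E i * (x $ i) ^ k\<close> over vertices. Counting incident pairs of a vertex and an
  edge in both orders turns this into a sum over edges.\<close>

lemma tensor_form_degree:
  fixes E :: "'n::finite set set"
  assumes "k > 0"
  shows "tensor_form k (degree_tensor k E) x = (\<Sum>e\<in>E. \<Sum>i\<in>e. (x $ i) ^ k)"
proof -
  \<comment> \<open>Injectivity relies on \<open>k > 0\<close>: \<open>replicate 0 i\<close> is the
    empty list for every \<open>i\<close>.\<close>
  have inj: "inj (replicate k :: 'n \<Rightarrow> 'n list)"
    using assms by (auto simp: inj_on_def)
  have "tensor_form k (degree_tensor k E) x
      = (\<Sum>is\<in>range (replicate k). degree_tensor k E is * (\<Prod>m<k. x $ (is ! m)))"
    unfolding tensor_form_def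
    by (rule sum.mono_neutral_right) (auto simp: degree_tensor_def)
  also have "\<dots> = (\<Sum>i\<in>UNIV. real (degree E i) * (x $ i) ^ k)"
    using assms by (subst sum.reindex[OF inj]) (auto simp: degree_tensor_def)
  also have "\<dots> = (\<Sum>i\<in>UNIV. \<Sum>e\<in>E. if i \<in> e then (x $ i) ^ k else 0)"
    by (simp add: degree_def sum.If_cases Int_def)
  also have "\<dots> = (\<Sum>e\<in>E. \<Sum>i\<in>e. (x $ i) ^ k)"
    by (subst sum.swap) (simp add: sum.If_cases)
  finally show ?thesis .
qed

text \<open>A list whose length equals the cardinality of its underlying set has no
  repetitions.\<close>

lemma lists_of_set_eq_permutations:
  assumes "card e = k"
  shows "{is :: 'n::finite list. length is = k \<and> set is = e} = permutations_of_set e"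
  using assms by (auto simp: permutations_of_set_def intro: card_distinct dest: distinct_card)

text \<open>Each edge is the underlying set of exactly \<open>k!\<close> index lists. All of them
  give the same monomial with weight \<open>1 / (k - 1)!\<close>, so the edge collects the factor
  \<open>k! / (k - 1)! = k\<close>.\<close>

lemma tensor_form_adjacency:
  fixes E :: "'n::finite set set"
  assumes "k > 0" "k_graph k E"
  shows "tensor_form k (adjacency_tensor k E) x = (\<Sum>e\<in>E. real k * (\<Prod>i\<in>e. x $ i))"
proof -
  let ?g = "\<lambda>is :: 'n list. 1 / fact (k - 1) * (\<Prod>m<k. x $ (is ! m))"
  have "tensor_form k (adjacency_tensor k E) x = (\<Sum>is | length is = k \<and> set is \<in> E. ?g is)"
    unfolding tensor_form_def
    by (rule sum.mono_neutral_cong_right) (auto simp: adjacency_tensor_def)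
  also have "\<dots> = (\<Sum>e\<in>E. \<Sum>is | is \<in> {is. length is = k \<and> set is \<in> E} \<and> set is = e. ?g is)"
    by (rule sum.group[symmetric]) (auto intro: finite_subset[OF _ finite_lists_length[of k]])
  also have "\<dots> = (\<Sum>e\<in>E. real k * (\<Prod>i\<in>e. x $ i))"
  proof (rule sum.cong[OF refl])
    fix e assume "e \<in> E"
    then have card: "card e = k"
      using assms by (simp add: k_graph_def)
    have "{is. is \<in> {is. length is = k \<and> set is \<in> E} \<and> set is = e} = permutations_of_set e"
      using \<open>e \<in> E\<close> by (auto simp: lists_of_set_eq_permutations[OF card, symmetric])
    moreover have "?g is = 1 / fact (k - 1) * (\<Prod>i\<in>e. x $ i)" if "is \<in> permutations_of_set e" for "is"
    proof -
      have "distinct is" "set is = e" "length is = k"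
        using that card by (auto simp: permutations_of_set_def distinct_card)
      \<comment> \<open>A distinct list is a bijection from its positions onto
        \<open>e\<close>.\<close>
      then have "(\<Prod>m<k. x $ (is ! m)) = (\<Prod>i\<in>e. x $ i)"
        by (intro prod.reindex_bij_betw bij_betw_nth) auto
      then show ?thesis by simp
    qed
    ultimately show "(\<Sum>is | is \<in> {is. length is = k \<and> set is \<in> E} \<and> set is = e. ?g is)
        = real k * (\<Prod>i\<in>e. x $ i)"
      using assms card by (simp add: card_permutations_of_set fact_reduce)
  qed
  finally show ?thesis .
qed

text \<open>With the form split into one term per edge, a test vector can be evaluated edge by
  edge.\<close>

lemma tensor_form_laplacian:
  fixes E :: "'n::finite set set"
  assumes "k > 0" "k_graph k E"
  shows "tensor_form k (laplacian_tensor k E) x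
    = (\<Sum>e\<in>E. (\<Sum>i\<in>e. (x $ i) ^ k) - real k * (\<Prod>i\<in>e. x $ i))"
proof -
  have "tensor_form k (laplacian_tensor k E) x
      = tensor_form k (degree_tensor k E) x - tensor_form k (adjacency_tensor k E) x"
    by (simp add: tensor_form_def laplacian_tensor_def left_diff_distrib sum_subtractf)
  then show ?thesis
    using assms by (simp add: tensor_form_degree tensor_form_adjacency sum_subtractf)
qed

lemma analytic_connectivity_le:
  fixes E :: "'n::finite set set"
  assumes "k > 0" "x \<in> feasible k j"
  shows "analytic_connectivity k E \<le> tensor_form k (laplacian_tensor k E) x"
proof -
  let ?f = "tensor_form k (laplacian_tensor k E)"
  \<comment> \<open>On the reals, \<open>INF\<close> is known to be a lower bound only for sets
    bounded below; compactness of the image supplies this.\<close>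
  have "compact (?f ` feasible k j)"
    using assms(1) by (intro compact_continuous_image continuous_on_tensor_form compact_feasible)
  then have "(INF y\<in>feasible k j. ?f y) \<le> ?f x"
    using assms(2) by (intro cINF_lower bounded_imp_bdd_below compact_imp_bounded)
  moreover have "analytic_connectivity k E \<le> (INF y\<in>feasible k j. ?f y)"
    unfolding analytic_connectivity_def by (rule Min_le) auto
  ultimately show ?thesis
    by linarith
qed

lemma card_mult_analytic_connectivity_le:
  fixes E :: "'n::finite set set"
  assumes "k > 0" "k_graph k E" "S \<noteq> {}" "S \<noteq> UNIV"
  shows "real (card S) * analytic_connectivity k E \<le> (\<Sum>e\<in>edge_cut E S. real (card (e \<inter> S)))"
proof -
  \<comment> \<open>The scaling makes the \<open>k\<close>-th powers of the entries of
    \<open>x\<close> sum to 1.\<close>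
  define c where "c = 1 / root k (real (card S))"
  define x :: "real ^ 'n" where "x = (\<chi> i. if i \<in> S then c else 0)"
  have S: "real (card S) > 0"
    using assms(3) by (simp add: card_gt_0_iff)
  have c: "c ^ k = 1 / real (card S)" "c \<ge> 0"
    using S assms(1) by (auto simp: c_def power_one_over)
  have power: "(x $ i) ^ k = (if i \<in> S then 1 / real (card S) else 0)" for i
    using c assms(1) by (simp add: x_def)
  have sum_power: "(\<Sum>i\<in>e. (x $ i) ^ k) = real (card (e \<inter> S)) / real (card S)" for e
    by (simp add: power sum.If_cases)
  \<comment> \<open>Feasibility asks for a vanishing coordinate; any vertex outside \<open>S\<close>
    provides it.\<close>
  obtain j where "j \<notin> S"
    using assms(4) by blast
  then have "x \<in> feasible k j"
    using c(2) assms(3) by (simp add: feasible_def sum_power) (simp add: x_def)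
  then have "analytic_connectivity k E \<le> tensor_form k (laplacian_tensor k E) x"
    by (rule analytic_connectivity_le[OF assms(1)])
  also have "\<dots> = (\<Sum>e\<in>E. (\<Sum>i\<in>e. (x $ i) ^ k) - real k * (\<Prod>i\<in>e. x $ i))"
    by (rule tensor_form_laplacian[OF assms(1,2)])
  also have "\<dots> = (\<Sum>e\<in>edge_cut E S. real (card (e \<inter> S)) / real (card S))"
  proof (rule sum.mono_neutral_cong_right)
    have card: "card e = k" if "e \<in> E" for e
      using that assms(2) by (simp add: k_graph_def)
    show "\<forall>e\<in>E - edge_cut E S. (\<Sum>i\<in>e. (x $ i) ^ k) - real k * (\<Prod>i\<in>e. x $ i) = 0"
    proof
      fix e assume e: "e \<in> E - edge_cut E S"
      then have "e \<noteq> {}"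
        using card[of e] assms(1) by auto
      consider "e \<subseteq> S" | "e \<inter> S = {}"
        using e by (auto simp: edge_cut_def)
      then show "(\<Sum>i\<in>e. (x $ i) ^ k) - real k * (\<Prod>i\<in>e. x $ i) = 0"
      proof cases
        \<comment> \<open>Inside \<open>S\<close> the power sum is \<open>k * c ^ k\<close>, since
          the edge has \<open>k\<close> vertices, and the product is \<open>c ^ k\<close>, so the
          two terms cancel.\<close>
        case 1
        then have "(\<Prod>i\<in>e. x $ i) = (\<Prod>i\<in>e. c)"
          by (intro prod.cong) (auto simp: x_def)
        then show ?thesis
          using 1 e c card[of e] by (simp add: sum_power Int_absorb2)
      next
        \<comment> \<open>Outside \<open>S\<close> all entries are 0. The empty product would be 1,
          hence the appeal to \<open>e \<noteq> {}\<close>.\<close>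
        case 2
        then have "(\<Prod>i\<in>e. x $ i) = 0"
          using \<open>e \<noteq> {}\<close> by (auto simp: x_def)
        with 2 show ?thesis
          by (simp add: sum_power)
      qed
    qed
    show "(\<Sum>i\<in>e. (x $ i) ^ k) - real k * (\<Prod>i\<in>e. x $ i) = real (card (e \<inter> S)) / real (card S)"
      if "e \<in> edge_cut E S" for e
    proof -
      \<comment> \<open>A cut edge has a vertex outside \<open>S\<close>, where \<open>x\<close>
        vanishes, so only the power sum survives.\<close>
      have "(\<Prod>i\<in>e. x $ i) = 0"
        using that by (auto simp: x_def edge_cut_def)
      then show ?thesis
        by (simp add: sum_power)
    qed
  qed (auto simp: edge_cut_def)
  finally show ?thesis
    using S by (simp add: field_simps flip: sum_divide_distrib)
qed

lemma CARD_mult_analytic_connectivity_le: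
  fixes E :: "'n::finite set set"
  assumes "k > 0" "k_graph k E" "S \<noteq> {}" "S \<noteq> UNIV"
  shows "real CARD('n) * analytic_connectivity k E \<le> real k * real (card (edge_cut E S))"
proof -
  \<comment> \<open>By this symmetry the bounds for \<open>S\<close> and \<open>- S\<close> range
    over the same edges and can be added termwise.\<close>
  have cut: "edge_cut E (- S) = edge_cut E S"
    by (auto simp: edge_cut_def)
  have "real CARD('n) = real (card S) + real (card (- S))"
    using card_Int_Diff[of UNIV S] by (simp add: Compl_eq_Diff_UNIV)
  then have "real CARD('n) * analytic_connectivity k E
      = real (card S) * analytic_connectivity k E + real (card (- S)) * analytic_connectivity k E"
    by (simp add: distrib_right)
  also have "\<dots> \<le> (\<Sum>e\<in>edge_cut E S. real (card (e \<inter> S))) + (\<Sum>e\<in>edge_cut E S. real (card (e \<inter> - S)))"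
    using assms card_mult_analytic_connectivity_le[of k E S]
      card_mult_analytic_connectivity_le[of k E "- S"] unfolding cut
    by (intro add_mono) auto
  also have "\<dots> = (\<Sum>e\<in>edge_cut E S. real k)"
    unfolding sum.distrib[symmetric]
  proof (rule sum.cong[OF refl])
    fix e assume "e \<in> edge_cut E S"
    then have "card e = k"
      using assms(2) by (simp add: k_graph_def edge_cut_def)
    moreover have "card e = card (e \<inter> S) + card (e \<inter> - S)"
      using card_Int_Diff[of e S] by (simp add: Diff_eq)
    ultimately show "real (card (e \<inter> S)) + real (card (e \<inter> - S)) = real k"
      by simp
  qed
  finally show ?thesis
    by (simp add: mult.commute)
qed

theorem proposition18:
  fixes E :: "'n::finite set set" and k :: nat
  assumes "k \<ge> 2"
    and "k_graph k E"
    and "no_isolated_vertices E"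
  shows "real (edge_connectivity E) \<ge> real CARD('n) / real k * analytic_connectivity k E"
proof -
  let ?M = "{card (edge_cut E S) | S. S \<noteq> {} \<and> S \<noteq> UNIV}"
  \<comment> \<open>An edge with \<open>k \<ge> 2\<close> vertices forces at least two vertices, so
    a singleton is a proper subset. The set under \<open>Min\<close> is then nonempty and its
    minimum is attained by some cut.\<close>
  obtain e where "e \<in> E"
    using assms(3) by (auto simp: no_isolated_vertices_def)
  then have "CARD('n) \<ge> 2"
    using assms(1,2) card_mono[of UNIV e] by (auto simp: k_graph_def)
  then have "{undefined :: 'n} \<noteq> UNIV"
    by (metis card.empty card.insert empty_iff finite.emptyI not_less_eq_eq numeral_2_eq_2
        order_refl One_nat_def)
  then have "?M \<noteq> {}"
    by blast
  moreover have "finite ?M"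
    by simp
  ultimately have "edge_connectivity E \<in> ?M"
    unfolding edge_connectivity_def by (rule Min_in[rotated])
  then obtain S where "S \<noteq> {}" "S \<noteq> UNIV" "edge_connectivity E = card (edge_cut E S)"
    by blast
  then have "real CARD('n) * analytic_connectivity k E \<le> real k * real (edge_connectivity E)"
    using CARD_mult_analytic_connectivity_le[of k E S] assms(1,2) by simp
  then show ?thesis
    using assms(1) by (simp add: field_simps)
qed

end
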